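(* For every $\epsilon > 0$ there exists $\Delta_0 = \Delta_0(\epsilon)$ such that the following holds. For every $\Delta \ge \Delta_0$ there exists $N_0 = N_0(\Delta)$ such that if $G = (U \cup V, E)$ is a bipartite graph with bipartition $(U,V)$, $|U| = |V| = n \ge N_0$, and average degree $\Delta$, then $G$ contains a bi-hole of size $(1-\epsilon)\frac{\log \Delta}{\Delta} n$.
   Context: A bipartite graph $G=(U\cup V,E)$ has a prescribed vertex bipartition $(U,V)$; it is balanced if $|U|=|V|$. A balanced bipartite independent set (bi-hole) of size $t$ in $G$ is a pair $(X,Y)$ with $X \subseteq U$, $Y \subseteq V$, $|X| = |Y| = t$, such that no edge of $G$ has one endpoint in $X$ and the other in $Y$. The average degree is taken over all $2n$ vertices, i.e. $|E| = \Delta n$. $\log$ denotes the natural logarithm. Non-integer sizes are to be understood with floors/ceilings omitted (as in the paper). *)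

theory Defs
  imports Complex_Main
begin

definition bipartite_graph :: "'a set \<Rightarrow> 'a set \<Rightarrow> 'a set set \<Rightarrow> bool" where
  "bipartite_graph U V E \<longleftrightarrow>
     finite U \<and> finite V \<and> U \<inter> V = {} \<and> E \<subseteq> {{u, v} | u v. u \<in> U \<and> v \<in> V}"

definition degree :: "'a set set \<Rightarrow> 'a \<Rightarrow> nat" where
  "degree E x = card {e \<in> E. x \<in> e}"

definition average_degree :: "'a set \<Rightarrow> 'a set set \<Rightarrow> real" where
  "average_degree W E = (\<Sum>x\<in>W. real (degree E x)) / real (card W)"

definition bi_hole ::
  "'a set \<Rightarrow> 'a set \<Rightarrow> 'a set set \<Rightarrow> nat \<Rightarrow> 'a set \<Rightarrow> 'a set \<Rightarrow> bool" where
  "bi_hole U V E t X Y \<longleftrightarrow>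
     X \<subseteq> U \<and> Y \<subseteq> V \<and> card X = t \<and> card Y = t \<and> (\<forall>x\<in>X. \<forall>y\<in>Y. {x, y} \<notin> E)"

text \<open>Rounding up is the strongest reading of a non-integer size: subsets of equal size of the
  two sides of a bi-hole again form a bi-hole, so the rounded-down version follows.  A negative
  size, which occurs for \<open>\<epsilon> > 1\<close>, becomes 0.\<close>

definition bi_hole_size :: "real \<Rightarrow> real \<Rightarrow> nat \<Rightarrow> nat" where
  "bi_hole_size \<epsilon> \<Delta> n = nat \<lceil>(1 - \<epsilon>) * (ln \<Delta> / \<Delta>) * real n\<rceil>"

end

theory Submission
  imports Defs "HOL-Real_Asymp.Real_Asymp"
begin

text \<open>A uniformly random \<open>t\<close>-subset \<open>X\<close> of \<open>U\<close> misses the neighbourhood of a vertex of degree \<open>d\<close>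
  in \<open>V\<close> with probability at least \<open>(1 - d / (n - t)) ^ t\<close>.  This is convex in \<open>d\<close>, and the degrees
  in \<open>V\<close> average to \<open>\<Delta>\<close>, so the expected number of vertices of \<open>V\<close> without a neighbour in \<open>X\<close> is
  at least \<open>n (1 - \<Delta> / (n - t)) ^ t\<close>.  For \<open>t \<approx> (1 - \<epsilon>) (ln \<Delta> / \<Delta>) n\<close> this is roughly
  \<open>n \<Delta> powr (\<epsilon> - 1)\<close>, which exceeds \<open>t\<close>.\<close>

section \<open>Random \<open>t\<close>-subsets: ratios of binomial coefficients, convexity and
  double counting\<close>

lemma Suc_times_choose_Suc: "Suc k * (n choose Suc k) = (n - k) * (n choose k)"
proof -
  have "Suc k * (n choose Suc k) = n * (n - 1 choose k)" by (rule binomial_absorption)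
  also have "\<dots> = (n - k) * (n choose k)" by (rule binomial_absorb_comp[symmetric])
  finally show ?thesis .
qed

text \<open>For \<open>t \<le> n\<close> the ratio of the two binomial coefficients is the product
  of the factors \<open>(n - d - i) / (n - i)\<close> over \<open>i < t\<close>, so a common lower
  bound \<open>y\<close> of the factors enters with power \<open>t\<close>. The form without
  division tolerates truncated subtraction.\<close>

lemma choose_diff_ge:
  fixes y :: real
  assumes "0 \<le> y" "\<And>i. i < t \<Longrightarrow> y * real (n - i) \<le> real (n - d - i)"
  shows "y ^ t * real (n choose t) \<le> real (n - d choose t)"
  using assms(2)
proof (induction t)
  case (Suc t)
  have rec: "real (Suc t) * real (m choose Suc t) = real (m - t) * real (m choose t)" for m
    by (metis Suc_times_choose_Suc of_nat_mult)
  have "real (Suc t) * (y ^ Suc t * real (n choose Suc t)) =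
          (y * real (n - t)) * (y ^ t * real (n choose t))"
    using rec[of n] by (simp add: mult_ac)
  also have "\<dots> \<le> real (n - d - t) * real (n - d choose t)"
    using Suc assms(1) by (intro mult_mono) auto
  also have "\<dots> = real (Suc t) * real (n - d choose Suc t)"
    by (rule rec[symmetric])
  finally show ?case
    by (simp only: mult_le_cancel_left_pos of_nat_0_less_iff zero_less_Suc)
qed simp

text \<open>For \<open>i < t\<close> the factor \<open>1 - d / (n - i)\<close> is at least
  \<open>1 - d / (n - t)\<close>. Cutting off at 0 covers degrees above \<open>n - t\<close>, where
  an even power of a negative number would give a false bound.\<close>

lemma choose_diff_ge_max:
  assumes "t < n"
  shows "max 0 (1 - real d / (real n - real t)) ^ t * real (n choose t) \<le> real (n - d choose t)"
proof (rule choose_diff_ge)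
  fix i assume i: "i < t"
  define y where "y = max 0 (1 - real d / (real n - real t))"
  show "y * real (n - i) \<le> real (n - d - i)"
  proof (cases "real d \<le> real n - real t")
    case True
    have "1 \<le> (real n - real i) / (real n - real t)"
      using i assms by simp
    then have "real d * 1 \<le> real d * ((real n - real i) / (real n - real t))"
      by (rule mult_left_mono) simp
    moreover have "y = 1 - real d / (real n - real t)"
      using True assms by (simp add: y_def)
    then have "y * (real n - real i) =
        (real n - real i) - real d * ((real n - real i) / (real n - real t))"
      by (simp add: left_diff_distrib)
    ultimately have "y * (real n - real i) \<le> real n - real d - real i"
      by linarith
    moreover have "real (n - i) = real n - real i" "real (n - d - i) = real n - real d - real i"
      using True i assms by (auto simp: of_nat_diff)
    ultimately show ?thesis
      by (simp only:)
  next
    case False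
    then have "y = 0" using assms by (simp add: y_def)
    then show ?thesis by simp
  qed
qed simp

text \<open>The left side is the tangent to the convex function \<open>y ^ t\<close> at
  \<open>a\<close>; Bernoulli's inequality applies because \<open>y / a - 1 \<ge> -1\<close>.
  Writing the slope with \<open>y / a\<close> avoids the exponent \<open>t - 1\<close>.\<close>

lemma power_tangent_le:
  fixes a y :: real
  assumes "0 < a" "0 \<le> y"
  shows "a ^ t + real t * a ^ t * (y / a - 1) \<le> y ^ t"
proof -
  have "1 + real t * (y / a - 1) \<le> (1 + (y / a - 1)) ^ t"
    using assms by (intro Bernoulli_inequality) simp
  then have "a ^ t * (1 + real t * (y / a - 1)) \<le> a ^ t * (y / a) ^ t"
    using assms by (intro mult_left_mono) auto
  also have "\<dots> = y ^ t"
    using assms by (simp flip: power_mult_distrib)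
  finally show ?thesis by (simp add: algebra_simps)
qed

text \<open>Jensen's inequality by summing tangents at \<open>a\<close>. Their slope is nonnegative,
  so a lower bound on the mean of \<open>y\<close> suffices.\<close>

lemma sum_power_ge:
  fixes y :: "'b \<Rightarrow> real"
  assumes "0 < a" "\<And>v. v \<in> V \<Longrightarrow> 0 \<le> y v" "real (card V) * a \<le> sum y V"
  shows "real (card V) * a ^ t \<le> (\<Sum>v\<in>V. y v ^ t)"
proof -
  have "0 \<le> real t * a ^ t * ((\<Sum>v\<in>V. y v) / a - real (card V))"
    using assms by (intro mult_nonneg_nonneg) (auto simp: field_simps)
  then have "real (card V) * a ^ t \<le> (\<Sum>v\<in>V. a ^ t + real t * a ^ t * (y v / a - 1))"
    by (simp add: sum.distrib sum_subtractf flip: sum_distrib_left sum_divide_distrib)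
  also have "\<dots> \<le> (\<Sum>v\<in>V. y v ^ t)"
    using assms by (intro sum_mono power_tangent_le) auto
  finally show ?thesis .
qed

text \<open>First-moment argument: pairs of a \<open>t\<close>-set \<open>X\<close> and a vertex
  \<open>v\<close> unrelated to all of \<open>X\<close> are counted in two ways. If every
  \<open>X\<close> fell short of the claimed number, the total would be smaller than the bound
  obtained by summing over \<open>v\<close>.\<close>

lemma exists_subset_large_common_nonneighbourhood:
  fixes R :: "'a \<Rightarrow> 'b \<Rightarrow> bool"
  assumes fin: "finite U" "finite V" and "t < card U"
    and avg: "(\<Sum>v\<in>V. real (card {u\<in>U. R u v})) = \<Delta> * real (card V)"
    and pos: "0 < 1 - \<Delta> / (real (card U) - real t)"
  shows "\<exists>X\<subseteq>U. card X = t \<and>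
    real (card V) * (1 - \<Delta> / (real (card U) - real t)) ^ t \<le> real (card {v\<in>V. \<forall>x\<in>X. \<not> R x v})"
proof (rule ccontr)
  define n where "n = card U"
  define a where "a = 1 - \<Delta> / (real n - real t)"
  define d where "d v = card {u\<in>U. R u v}" for v
  define \<X> where "\<X> = {X. X \<subseteq> U \<and> card X = t}"
  assume "\<not> ?thesis"
  then have small: "real (card {v\<in>V. \<forall>x\<in>X. \<not> R x v}) < real (card V) * a ^ t" if "X \<in> \<X>" for X
    using that by (auto simp: \<X>_def a_def n_def not_le)
  have card_X: "card \<X> = n choose t"
    unfolding \<X>_def n_def by (rule n_subsets[OF fin(1)])
  \<comment> \<open>At least one \<open>t\<close>-subset must exist for the comparison of sums over
    \<open>\<X>\<close> below to be strict.\<close>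
  then have "0 < card \<X>" using assms(3) by (simp add: n_def)
  then have X: "finite \<X>" "\<X> \<noteq> {}" by (auto simp: card_gt_0_iff)
  have count: "card {X\<in>\<X>. \<forall>x\<in>X. \<not> R x v} = (n - d v choose t)" for v
  proof -
    have "{X\<in>\<X>. \<forall>x\<in>X. \<not> R x v} = {X. X \<subseteq> U - {u\<in>U. R u v} \<and> card X = t}"
      by (auto simp: \<X>_def)
    moreover have "card (U - {u\<in>U. R u v}) = n - d v"
      using fin by (simp add: card_Diff_subset n_def d_def)
    ultimately show ?thesis using n_subsets[of "U - {u\<in>U. R u v}" t] fin by simp
  qed
  have nt: "0 < real n - real t" using assms(3) by (simp add: n_def)
  \<comment> \<open>Before the cut-off at 0 the mean is exactly \<open>a\<close>, by linearity in
    the degree; the cut-off can only raise it.\<close>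
  have "real (card V) * a = (\<Sum>v\<in>V. 1 - real (d v) / (real n - real t))"
    using avg by (simp add: a_def d_def sum_subtractf algebra_simps flip: sum_divide_distrib)
  also have "\<dots> \<le> (\<Sum>v\<in>V. max 0 (1 - real (d v) / (real n - real t)))"
    by (intro sum_mono) simp
  finally have "real (card V) * a ^ t \<le> (\<Sum>v\<in>V. max 0 (1 - real (d v) / (real n - real t)) ^ t)"
    using pos by (intro sum_power_ge) (auto simp: a_def n_def)
  then have "real (card V) * a ^ t * real (n choose t) \<le>
      (\<Sum>v\<in>V. max 0 (1 - real (d v) / (real n - real t)) ^ t) * real (n choose t)"
    by (rule mult_right_mono) simp
  also have "\<dots> \<le> (\<Sum>v\<in>V. real (n - d v choose t))"
    unfolding sum_distrib_right using assms(3)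
    by (intro sum_mono choose_diff_ge_max) (simp add: n_def)
  also have "\<dots> = real (\<Sum>v\<in>V. card {X\<in>\<X>. \<forall>x\<in>X. \<not> R x v})"
    by (simp add: count)
  also have "\<dots> = real (\<Sum>X\<in>\<X>. card {v\<in>V. \<forall>x\<in>X. \<not> R x v})"
    using sum_multicount_gen[OF fin(2) X(1), of "\<lambda>v X. \<forall>x\<in>X. \<not> R x v"
        "\<lambda>X. card {v\<in>V. \<forall>x\<in>X. \<not> R x v}"] by simp
  also have "\<dots> < (\<Sum>X\<in>\<X>. real (card V) * a ^ t)"
    unfolding of_nat_sum using X small by (intro sum_strict_mono) auto
  also have "\<dots> = real (card V) * a ^ t * real (n choose t)"
    by (simp add: card_X)
  finally show False by simp
qed

section \<open>Degree sums in bipartite graphs and the reduction to an inequality between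
  \<open>n\<close>, \<open>t\<close> and \<open>\<Delta>\<close>\<close>

lemma bipartite_graph_commute: "bipartite_graph U V E \<Longrightarrow> bipartite_graph V U E"
  unfolding bipartite_graph_def by (blast intro: insert_commute)

text \<open>Since the sides are disjoint, each edge has exactly one endpoint in \<open>V\<close>, so
  counting incidences from \<open>V\<close> counts each edge once.\<close>

lemma sum_degree_bipartite:
  assumes "bipartite_graph U V E"
  shows "(\<Sum>v\<in>V. degree E v) = card E"
proof -
  have fin: "finite V" and E: "E \<subseteq> {{u, v} | u v. u \<in> U \<and> v \<in> V}" and "U \<inter> V = {}"
    using assms by (auto simp: bipartite_graph_def)
  have "finite E"
    using assms by (intro finite_subset[of E "Pow (U \<union> V)"]) (auto simp: bipartite_graph_def)
  moreover have "\<forall>e\<in>E. card {v\<in>V. v \<in> e} = 1"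
  proof
    fix e assume "e \<in> E"
    then obtain u v where "e = {u, v}" "u \<in> U" "v \<in> V" using E by blast
    then have "{v\<in>V. v \<in> e} = {v}" using \<open>U \<inter> V = {}\<close> by auto
    then show "card {v\<in>V. v \<in> e} = 1" by simp
  qed
  ultimately have "(\<Sum>v\<in>V. card {e\<in>E. v \<in> e}) = 1 * card E"
    by (intro sum_multicount[OF fin])
  then show ?thesis by (simp add: degree_def)
qed

lemma degree_eq_card_neighbours:
  assumes "bipartite_graph U V E" "v \<in> V"
  shows "degree E v = card {u\<in>U. {u, v} \<in> E}"
proof -
  have "{e\<in>E. v \<in> e} = (\<lambda>u. {u, v}) ` {u\<in>U. {u, v} \<in> E}"
    using assms unfolding bipartite_graph_def by blast
  moreover have "inj_on (\<lambda>u. {u, v}) {u\<in>U. {u, v} \<in> E}"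
    by (auto simp: inj_on_def doubleton_eq_iff)
  ultimately show ?thesis by (simp add: degree_def card_image)
qed

text \<open>Each side has degree sum \<open>card E\<close>, so the average over all
  \<open>2 * n\<close> vertices is also the average over \<open>V\<close> alone, which is what the
  random choice of \<open>X\<close> in \<open>U\<close> requires.\<close>

lemma sum_neighbours_eq_average_degree:
  assumes "bipartite_graph U V E" "card U = n" "card V = n" "0 < n"
  shows "(\<Sum>v\<in>V. real (card {u\<in>U. {u, v} \<in> E})) = average_degree (U \<union> V) E * real n"
proof -
  have fin: "finite U" "finite V" "U \<inter> V = {}"
    using assms(1) by (auto simp: bipartite_graph_def)
  have "(\<Sum>x\<in>U \<union> V. real (degree E x)) = real (\<Sum>x\<in>U. degree E x) + real (\<Sum>x\<in>V. degree E x)"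
    using fin by (simp add: sum.union_disjoint)
  also have "\<dots> = 2 * real (card E)"
    by (simp only: sum_degree_bipartite[OF assms(1)]
        sum_degree_bipartite[OF bipartite_graph_commute[OF assms(1)]])
  finally have "average_degree (U \<union> V) E * real n = real (card E)"
    using assms fin by (simp add: average_degree_def card_Un_disjoint)
  also have "\<dots> = (\<Sum>v\<in>V. real (card {u\<in>U. {u, v} \<in> E}))"
    by (simp add: degree_eq_card_neighbours[OF assms(1)] flip: sum_degree_bipartite[OF assms(1)])
  finally show ?thesis by simp
qed

text \<open>By \<open>large\<close>, some \<open>X\<close> leaves at least \<open>t\<close> vertices
  of \<open>V\<close> without a neighbour in \<open>X\<close>; any \<open>t\<close> of them serve as
  \<open>Y\<close>.\<close>

lemma bi_hole_exists:
  assumes G: "bipartite_graph U V E" "card U = n" "card V = n" and "t < n"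
    and "average_degree (U \<union> V) E = \<Delta>"
    and "0 < 1 - \<Delta> / (real n - real t)"
    and large: "real t \<le> real n * (1 - \<Delta> / (real n - real t)) ^ t"
  shows "\<exists>X Y. bi_hole U V E t X Y"
proof -
  have fin: "finite U" "finite V" using G by (auto simp: bipartite_graph_def)
  have "(\<Sum>v\<in>V. real (card {u\<in>U. {u, v} \<in> E})) = \<Delta> * real (card V)"
    using sum_neighbours_eq_average_degree[OF G] assms by simp
  from exists_subset_large_common_nonneighbourhood[OF fin _ this, of t] assms
  obtain X where X: "X \<subseteq> U" "card X = t"
    and "real n * (1 - \<Delta> / (real n - real t)) ^ t \<le> real (card {v\<in>V. \<forall>x\<in>X. {x, v} \<notin> E})"
    by auto
  with large have "t \<le> card {v\<in>V. \<forall>x\<in>X. {x, v} \<notin> E}" by linarith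
  then obtain Y where "Y \<subseteq> {v\<in>V. \<forall>x\<in>X. {x, v} \<notin> E}" "card Y = t"
    by (meson obtain_subset_with_card_n)
  with X have "bi_hole U V E t X Y" unfolding bi_hole_def by blast
  then show ?thesis by blast
qed

section \<open>Asymptotics: first large \<open>n\<close> for fixed \<open>\<Delta>\<close>, then
  large \<open>\<Delta>\<close>\<close>

lemma exp_le_power_one_minus:
  fixes x :: real
  assumes "0 \<le> x" "x < 1"
  shows "exp (- (real t * (x / (1 - x)))) \<le> (1 - x) ^ t"
proof -
  have "1 / (1 - x) = 1 + x / (1 - x)" using assms by (simp add: field_simps)
  also have "\<dots> \<le> exp (x / (1 - x))" by (rule exp_ge_add_one_self)
  finally have "exp (- (x / (1 - x))) \<le> 1 - x"
    using assms by (simp add: exp_minus field_simps)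
  then have "exp (- (x / (1 - x))) ^ t \<le> (1 - x) ^ t"
    by (intro power_mono) auto
  then show ?thesis by (simp add: exp_of_nat_mult[symmetric])
qed

text \<open>With \<open>t\<close> close to \<open>s * n\<close>, the power tends to
  \<open>exp (- (s * \<Delta> / (1 - s)))\<close>. After division by \<open>n\<close> the last
  inequality thus becomes \<open>key\<close> in the limit, and the strictness of \<open>key\<close>
  absorbs the rounding errors.\<close>

lemma eventually_expected_size_large:
  fixes s \<Delta> :: real
  assumes s: "0 \<le> s" "s < 1" and \<Delta>: "0 \<le> \<Delta>" and key: "s < exp (- (s * \<Delta> / (1 - s)))"
  shows "\<forall>\<^sub>F n in sequentially. nat \<lceil>s * real n\<rceil> < n \<and>
    0 < 1 - \<Delta> / (real n - real (nat \<lceil>s * real n\<rceil>)) \<and>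
    real (nat \<lceil>s * real n\<rceil>) \<le>
      real n * (1 - \<Delta> / (real n - real (nat \<lceil>s * real n\<rceil>))) ^ nat \<lceil>s * real n\<rceil>"
proof -
  \<comment> \<open>The exponent is \<open>- t * \<Delta> / (n - t - \<Delta>)\<close> with
    \<open>t\<close> replaced by its upper bound \<open>s * n + 1\<close> and the fraction reduced
    by \<open>n\<close>. The subtracted \<open>1 / n\<close> pays for the ceiling.\<close>
  have "(\<lambda>n. exp (- ((s + 1 / real n) * \<Delta> / ((1 - s) - (1 + \<Delta>) / real n))) - 1 / real n)
      \<longlonglongrightarrow> exp (- ((s + 0) * \<Delta> / ((1 - s) - 0))) - 0"
    using s by (intro tendsto_intros lim_const_over_n) auto
  then have "\<forall>\<^sub>F n in sequentially.
      s < exp (- ((s + 1 / real n) * \<Delta> / ((1 - s) - (1 + \<Delta>) / real n))) - 1 / real n"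
    using key by (intro order_tendstoD) auto
  \<comment> \<open>Multiplied by \<open>n\<close>, this denominator is
    \<open>n - (s * n + 1) - \<Delta>\<close>; its positivity will give
    \<open>\<Delta> < n - t\<close>, hence both \<open>x < 1\<close> and
    \<open>t < n\<close>.\<close>
  moreover have "(\<lambda>n. (1 - s) - (1 + \<Delta>) / real n) \<longlonglongrightarrow> (1 - s) - 0"
    by (intro tendsto_intros lim_const_over_n)
  then have "\<forall>\<^sub>F n in sequentially. 0 < (1 - s) - (1 + \<Delta>) / real n"
    using s by (intro order_tendstoD) auto
  ultimately show ?thesis
    using eventually_gt_at_top[of 0]
  proof eventually_elim
    case (elim n)
    define t where "t = nat \<lceil>s * real n\<rceil>"
    have t: "real t \<le> s * real n + 1" unfolding t_def using s by (simp add: ceiling_less_cancel)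
    have n: "0 < real n" using elim by simp
    have "0 < real n * ((1 - s) - (1 + \<Delta>) / real n)" using elim n by simp
    also have "\<dots> = real n - (s * real n + 1) - \<Delta>" using n by (simp add: field_simps)
    finally have den: "0 < real n - (s * real n + 1) - \<Delta>" .
    define x where "x = \<Delta> / (real n - real t)"
    have nt: "\<Delta> < real n - real t" using den t by linarith
    then have x: "0 \<le> x" "x < 1" using \<Delta> by (auto simp: x_def)
    have "x / (1 - x) = \<Delta> / (real n - real t - \<Delta>)"
    proof -
      have "1 - x = (real n - real t - \<Delta>) / (real n - real t)"
        using nt \<Delta> by (simp add: x_def diff_divide_distrib)
      then show ?thesis using nt \<Delta> by (simp add: x_def)
    qed
    \<comment> \<open>The left side is increasing in \<open>t\<close>, so \<open>t\<close> may be
      replaced by \<open>s * n + 1\<close>.\<close>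
    then have "real t * (x / (1 - x)) \<le> (s * real n + 1) * (\<Delta> / (real n - (s * real n + 1) - \<Delta>))"
      unfolding \<open>x / (1 - x) = _\<close> using t \<Delta> den s
      by (intro mult_mono divide_left_mono mult_pos_pos divide_nonneg_nonneg) auto
    also have "\<dots> = (s + 1 / real n) * \<Delta> / ((1 - s) - (1 + \<Delta>) / real n)"
    proof -
      have "s * real n + 1 = real n * (s + 1 / real n)"
        "real n - (s * real n + 1) - \<Delta> = real n * ((1 - s) - (1 + \<Delta>) / real n)"
        using n by (simp_all add: field_simps)
      then show ?thesis using n by simp
    qed
    finally have "s + 1 / real n \<le> exp (- (real t * (x / (1 - x))))"
      using elim by (smt (verit) exp_le_cancel_iff)
    also have "\<dots> \<le> (1 - x) ^ t" by (rule exp_le_power_one_minus[OF x])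
    finally have "real n * (s + 1 / real n) \<le> real n * (1 - x) ^ t"
      using n by (intro mult_left_mono) auto
    moreover have "real n * (s + 1 / real n) = s * real n + 1"
      using n by (simp add: field_simps)
    ultimately have "real t \<le> real n * (1 - x) ^ t" using t by linarith
    moreover have "t < n" using nt \<Delta> by linarith
    ultimately show ?case using x by (simp add: x_def flip: t_def)
  qed
qed

text \<open>The margin \<open>\<epsilon>\<close> is split in two. One half compensates the
  denominator \<open>1 - s\<close>, as \<open>s\<close> tends to 0, so that the exponential is at
  least \<open>\<Delta> powr (\<epsilon> / 2 - 1)\<close>; the other half beats the logarithm in
  \<open>s\<close>, as \<open>ln \<Delta> < \<Delta> powr (\<epsilon> / 2)\<close>
  eventually.\<close>

lemma eventually_density_admissible:
  fixes \<epsilon> :: real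
  assumes "0 < \<epsilon>" "\<epsilon> < 1"
  shows "\<forall>\<^sub>F \<Delta> in at_top. 1 < \<Delta> \<and> (1 - \<epsilon>) * (ln \<Delta> / \<Delta>) < 1 \<and>
    (1 - \<epsilon>) * (ln \<Delta> / \<Delta>) < exp (- ((1 - \<epsilon>) * (ln \<Delta> / \<Delta>) * \<Delta> / (1 - (1 - \<epsilon>) * (ln \<Delta> / \<Delta>))))"
proof -
  have "((\<lambda>\<Delta>::real. (1 - \<epsilon>) * (ln \<Delta> / \<Delta>)) \<longlongrightarrow> 0) at_top"
    by real_asymp
  then have "\<forall>\<^sub>F \<Delta> in at_top. (1 - \<epsilon>) * (ln \<Delta> / \<Delta>) < \<epsilon> / 2"
    using assms by (intro order_tendstoD) auto
  moreover have "((\<lambda>\<Delta>::real. ln \<Delta> / \<Delta> powr (\<epsilon> / 2)) \<longlongrightarrow> 0) at_top"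
    using assms by real_asymp
  then have "\<forall>\<^sub>F \<Delta>::real in at_top. ln \<Delta> / \<Delta> powr (\<epsilon> / 2) < 1"
    by (intro order_tendstoD) auto
  ultimately show ?thesis
    using eventually_gt_at_top[of "1::real"]
  proof eventually_elim
    case (elim \<Delta>)
    define s where "s = (1 - \<epsilon>) * (ln \<Delta> / \<Delta>)"
    have s: "s < \<epsilon> / 2" using elim by (simp add: s_def)
    have L: "0 < ln \<Delta>" using elim by simp
    \<comment> \<open>The two sides differ by \<open>(\<epsilon> / 2)\<^sup>2\<close>; one factor on
      the right is then traded for the larger \<open>1 - s\<close>.\<close>
    have "(1 - \<epsilon>) \<le> (1 - \<epsilon> / 2) * (1 - \<epsilon> / 2)"
      by (simp add: algebra_simps)
    also have "\<dots> \<le> (1 - \<epsilon> / 2) * (1 - s)"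
      using s assms by (intro mult_left_mono) auto
    finally have "(1 - \<epsilon>) / (1 - s) \<le> 1 - \<epsilon> / 2"
      using s assms by (simp add: field_simps)
    then have "(1 - \<epsilon>) / (1 - s) * ln \<Delta> \<le> (1 - \<epsilon> / 2) * ln \<Delta>"
      using L by (intro mult_right_mono) auto
    moreover have "s * \<Delta> = (1 - \<epsilon>) * ln \<Delta>"
      using elim by (simp add: s_def)
    then have "s * \<Delta> / (1 - s) = (1 - \<epsilon>) / (1 - s) * ln \<Delta>"
      by simp
    ultimately have "s * \<Delta> / (1 - s) \<le> (1 - \<epsilon> / 2) * ln \<Delta>"
      by linarith
    then have "exp (- ((1 - \<epsilon> / 2) * ln \<Delta>)) \<le> exp (- (s * \<Delta> / (1 - s)))"
      by simp
    moreover have "exp (- ((1 - \<epsilon> / 2) * ln \<Delta>)) = \<Delta> powr (\<epsilon> / 2) / \<Delta>"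
      using elim by (simp add: powr_def exp_diff algebra_simps)
    moreover have "s < \<Delta> powr (\<epsilon> / 2) / \<Delta>"
    proof -
      have "(1 - \<epsilon>) * ln \<Delta> \<le> ln \<Delta>" using L assms by (simp add: algebra_simps)
      also have "\<dots> < \<Delta> powr (\<epsilon> / 2)" using elim by (simp add: field_simps)
      finally show ?thesis using elim by (simp add: s_def divide_strict_right_mono)
    qed
    ultimately show ?case
      using elim s assms unfolding s_def[symmetric] by linarith
  qed
qed

theorem theorem1p1:
  fixes \<epsilon> :: real
  assumes "\<epsilon> > 0"
  shows "\<exists>\<Delta>\<^sub>0::real. \<forall>\<Delta>\<ge>\<Delta>\<^sub>0. \<exists>N\<^sub>0::nat. \<forall>(U :: 'a set) V E n.
           bipartite_graph U V E \<and> card U = n \<and> card V = n \<and> n \<ge> N\<^sub>0 \<and>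
           average_degree (U \<union> V) E = \<Delta> \<longrightarrow>
           (\<exists>X Y. bi_hole U V E (bi_hole_size \<epsilon> \<Delta> n) X Y)"
proof (cases "\<epsilon> < 1")
  case True
  obtain \<Delta>\<^sub>0 where D: "\<And>\<Delta>. \<Delta> \<ge> \<Delta>\<^sub>0 \<Longrightarrow> 1 < \<Delta> \<and> (1 - \<epsilon>) * (ln \<Delta> / \<Delta>) < 1 \<and>
      (1 - \<epsilon>) * (ln \<Delta> / \<Delta>) < exp (- ((1 - \<epsilon>) * (ln \<Delta> / \<Delta>) * \<Delta> / (1 - (1 - \<epsilon>) * (ln \<Delta> / \<Delta>))))"
    using eventually_density_admissible[OF assms True] unfolding eventually_at_top_linorder by blast
  show ?thesis
  proof (intro exI[of _ \<Delta>\<^sub>0] allI impI)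
    fix \<Delta> assume "\<Delta>\<^sub>0 \<le> \<Delta>"
    from D[OF this] have "0 \<le> (1 - \<epsilon>) * (ln \<Delta> / \<Delta>)" "0 \<le> \<Delta>" using True by auto
    \<comment> \<open>With \<open>\<Delta>\<close> fixed, the density
      \<open>s = (1 - \<epsilon>) * (ln \<Delta> / \<Delta>)\<close> is a constant, and
      \<open>nat \<lceil>s * real n\<rceil>\<close> is the size of the bi-hole.\<close>
    with D[OF \<open>\<Delta>\<^sub>0 \<le> \<Delta>\<close>] eventually_expected_size_large obtain N\<^sub>0 where
      "\<And>n. n \<ge> N\<^sub>0 \<Longrightarrow> bi_hole_size \<epsilon> \<Delta> n < n \<and>
        0 < 1 - \<Delta> / (real n - real (bi_hole_size \<epsilon> \<Delta> n)) \<and>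
        real (bi_hole_size \<epsilon> \<Delta> n) \<le>
          real n * (1 - \<Delta> / (real n - real (bi_hole_size \<epsilon> \<Delta> n))) ^ bi_hole_size \<epsilon> \<Delta> n"
      unfolding eventually_sequentially bi_hole_size_def by blast
    then show "\<exists>N\<^sub>0. \<forall>(U :: 'a set) V E n.
        bipartite_graph U V E \<and> card U = n \<and> card V = n \<and> n \<ge> N\<^sub>0 \<and>
        average_degree (U \<union> V) E = \<Delta> \<longrightarrow> (\<exists>X Y. bi_hole U V E (bi_hole_size \<epsilon> \<Delta> n) X Y)"
      by (intro exI[of _ N\<^sub>0] allI impI bi_hole_exists) auto
  qed
next
  case False
  \<comment> \<open>For \<open>\<epsilon> \<ge> 1\<close> and \<open>\<Delta> \<ge> 1\<close> the
    real size is at most 0, so \<open>nat\<close> turns it into 0 and the empty pair is a bi-hole;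
    the threshold for \<open>\<Delta>\<close> is 1.\<close>
  have "bi_hole_size \<epsilon> \<Delta> n = 0" if "1 \<le> \<Delta>" for \<Delta> n
  proof -
    have "(1 - \<epsilon>) * (ln \<Delta> / \<Delta>) * real n \<le> 0"
      using False that by (intro mult_nonpos_nonneg) auto
    then show ?thesis unfolding bi_hole_size_def by (simp only: ceiling_le_zero nat_0_iff)
  qed
  then have "bi_hole U V E (bi_hole_size \<epsilon> \<Delta> n) {} {}" if "1 \<le> \<Delta>" for U V :: "'a set" and E \<Delta> n
    using that by (simp add: bi_hole_def)
  then show ?thesis by blast
qed

end
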